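(* Let $q$ be a complex number with $0<|q|<1$. Define sequences $(Q_m)_{m\ge -1}$ and $(R_m)_{m\ge -1}$ by $$Q_m=(1+q^{m-1})Q_{m-1}+q^{m-1}Q_{m-2}\quad(m\ge 2),\qquad Q_{-1}=1,\ Q_0=0,\ Q_1=1,$$ $$R_m=(1+q^{m-1})R_{m-1}+q^{m-1}R_{m-2}\quad(m\ge 2),\qquad R_{-1}=-1,\ R_0=1,\ R_1=1.$$ Then for every integer $m\ge 0$, $$\sum_{n=0}^{\infty}\frac{(-q;q)_n\, q^{n(n+2m-1)/2}}{(q;q)_n}=(-1)^mq^{-\binom{m}{2}}Q_{m-1}\frac{(-q;q^2)_{\infty}}{(q;q^2)_{\infty}}-(-1)^mq^{-\binom{m}{2}}R_{m-1}\frac{(q^4;q^4)_{\infty}}{(q;q)_{\infty}}.$$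
   Context: For $|p|<1$, $(a;p)_\infty=\prod_{k=0}^{\infty}(1-ap^k)$ and $(a;p)_n=(a;p)_\infty/(ap^n;p)_\infty$, so that for an integer $n\ge 0$, $(a;p)_n=\prod_{k=0}^{n-1}(1-ap^k)$. *)

theory Defs
  imports "HOL-Analysis.Analysis"
begin

definition qpoch_inf :: "complex \<Rightarrow> complex \<Rightarrow> complex" where
  "qpoch_inf a p = (\<Prod>k. 1 - a * p ^ k)"

text \<open>
  The quotient is the intended value only when \<open>(a p^n; p)\<^sub>\<infinity>\<close> does not vanish; otherwise it is
  \<open>0\<close> by the convention on division by zero.
\<close>

definition qpoch :: "complex \<Rightarrow> complex \<Rightarrow> nat \<Rightarrow> complex" where
  "qpoch a p n = qpoch_inf a p / qpoch_inf (a * p ^ n) p"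

lemma convergent_prod_qpoch:
  fixes a p :: complex
  assumes "norm p < 1"
  shows "convergent_prod (\<lambda>k. 1 - a * p ^ k)"
proof -
  have "summable (\<lambda>k. norm (- (a * p ^ k)))"
    using assms by (simp add: norm_mult norm_power summable_mult summable_geometric)
  then have "abs_convergent_prod (\<lambda>k. 1 + - (a * p ^ k))"
    by (intro summable_imp_abs_convergent_prod) simp_all
  then show ?thesis
    using abs_convergent_prod_imp_convergent_prod by fastforce
qed

lemma qpoch_eq_prod:
  assumes "norm p < 1" and "\<And>k. a * p ^ k \<noteq> 1"
  shows "qpoch a p n = (\<Prod>k<n. 1 - a * p ^ k)"
proof -
  have nz: "1 - a * p ^ k \<noteq> 0" for k
    using assms(2)[of k] by simp
  have nz': "1 - a * p ^ n * p ^ k \<noteq> 0" for k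
    using assms(2)[of "n + k"] by (simp add: power_add mult.assoc)
  have "qpoch_inf (a * p ^ n) p \<noteq> 0"
    unfolding qpoch_inf_def
    by (rule prodinf_nonzero[OF convergent_prod_qpoch[OF assms(1)] nz'])
  moreover have "qpoch_inf a p = qpoch_inf (a * p ^ n) p * (\<Prod>k<n. 1 - a * p ^ k)"
    unfolding qpoch_inf_def
    using prodinf_split_initial_segment[OF convergent_prod_qpoch[OF assms(1)], of n a] nz
    by (simp add: power_add algebra_simps)
  ultimately show ?thesis
    by (simp add: qpoch_def)
qed

end

theory Submission
  imports Defs
begin

text \<open>
  Put \<open>G(a, x) = \<Sum>\<^sub>n (-aq; q)\<^sub>n q\<^bsup>n(n-1)/2\<^esup> x\<^sup>n / (q; q)\<^sub>n\<close>. Two termwise identities,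
  \<open>G(a, x) + aq G(a, qx) = (1 + aq) G(aq, x)\<close> and \<open>G(a, x) - G(a, qx) = x (1 + aq) G(aq, qx)\<close>,
  drive everything. Combined at \<open>x \<in> {1, q}\<close> they give \<open>G(a, q) = (1 + aq\<^sup>2) G(aq\<^sup>2, q)\<close>; iterating
  and evaluating \<open>G(0, q)\<close> by Euler's identity yields Lebesgue's identity
  \<open>G(a, q) = (-aq\<^sup>2; q\<^sup>2)\<^sub>\<infinity> (-q; q)\<^sub>\<infinity>\<close>. The series of the theorem is \<open>G(1, q\<^sup>m)\<close>. Combined at
  \<open>a = 1\<close> they give \<open>G(1, x) = (1 + x) G(1, qx) + qx G(1, q\<^sup>2x)\<close>, a three-term recurrence in \<open>m\<close>
  that the right-hand side also satisfies; the initial values at \<open>m = 0, 1\<close> come from Lebesgue's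
  identity with \<open>a = q\<close> and \<open>a = 1\<close>.
\<close>

section \<open>Infinite products\<close>

lemma qpoch_inf_LIMSEQ:
  assumes "norm p < 1"
  shows "(\<lambda>n. \<Prod>k<n. 1 - a * p ^ k) \<longlonglongrightarrow> qpoch_inf a p"
  using convergent_prod_LIMSEQ[OF convergent_prod_qpoch[OF assms, of a]]
  unfolding qpoch_inf_def by (simp add: LIMSEQ_lessThan_iff_atMost)

lemma mult_power_neq_1:
  fixes a p :: "'a :: real_normed_field"
  assumes "norm a < 1" "norm p < 1"
  shows "a * p ^ k \<noteq> 1"
proof
  assume "a * p ^ k = 1"
  then have "norm a * norm p ^ k = 1"
    by (metis norm_mult norm_one norm_power)
  moreover have "norm a * norm p ^ k \<le> norm a * 1"
    using assms by (intro mult_left_mono power_le_one) auto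
  ultimately show False using assms by simp
qed

lemma qpoch_inf_nonzero:
  assumes "norm a < 1" "norm p < 1"
  shows "qpoch_inf a p \<noteq> 0"
  unfolding qpoch_inf_def
proof (rule prodinf_nonzero[OF convergent_prod_qpoch[OF assms(2)]])
  show "1 - a * p ^ k \<noteq> 0" for k
    using mult_power_neq_1[OF assms, of k] by simp
qed

lemma qpoch_inf_minus_mult:
  assumes "norm p < 1"
  shows "qpoch_inf (-a) p * qpoch_inf a p = qpoch_inf (a\<^sup>2) (p\<^sup>2)"
proof -
  have "(1 - (-a) * p ^ k) * (1 - a * p ^ k) = 1 - a\<^sup>2 * (p\<^sup>2) ^ k" for k
    by (simp add: algebra_simps power2_eq_square power_mult_distrib)
  then show ?thesis
    unfolding qpoch_inf_def
    using prodinf_mult[OF convergent_prod_qpoch[OF assms, of "-a"] convergent_prod_qpoch[OF assms, of a]]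
    by simp
qed

lemma qpoch_inf_even_odd:
  assumes "norm p < 1"
  shows "qpoch_inf a p = qpoch_inf a (p\<^sup>2) * qpoch_inf (a * p) (p\<^sup>2)"
proof -
  have p2: "norm (p\<^sup>2) < 1"
    using assms by (simp add: norm_power power_less_one_iff)
  have split: "(\<Prod>k<2 * n. 1 - a * p ^ k)
      = (\<Prod>k<n. 1 - a * (p\<^sup>2) ^ k) * (\<Prod>k<n. 1 - a * p * (p\<^sup>2) ^ k)" for n
    by (induction n) (simp_all add: power2_eq_square power_mult_distrib mult_2_right power_add mult_ac)
  have "(\<lambda>n. \<Prod>k<2 * n. 1 - a * p ^ k) \<longlonglongrightarrow> qpoch_inf a (p\<^sup>2) * qpoch_inf (a * p) (p\<^sup>2)"
    unfolding split by (intro tendsto_mult qpoch_inf_LIMSEQ p2)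
  moreover have "(\<lambda>n. \<Prod>k<2 * n. 1 - a * p ^ k) \<longlonglongrightarrow> qpoch_inf a p"
    using LIMSEQ_subseq_LIMSEQ[OF qpoch_inf_LIMSEQ[OF assms, of a], of "\<lambda>n. 2 * n"]
    by (simp add: o_def strict_mono_def)
  ultimately show ?thesis
    using LIMSEQ_unique by blast
qed

lemma qpoch_inf_split_first:
  assumes "norm p < 1"
  shows "qpoch_inf a p = (1 - a) * qpoch_inf (a * p) p"
proof -
  have "(\<Prod>k<Suc n. 1 - a * p ^ k) = (1 - a) * (\<Prod>k<n. 1 - a * p * p ^ k)" for n
    by (subst prod.lessThan_Suc_shift) (simp add: mult_ac)
  then have "(\<lambda>n. \<Prod>k<Suc n. 1 - a * p ^ k) \<longlonglongrightarrow> (1 - a) * qpoch_inf (a * p) p"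
    by (simp only:) (intro tendsto_mult tendsto_const qpoch_inf_LIMSEQ assms)
  moreover have "(\<lambda>n. \<Prod>k<Suc n. 1 - a * p ^ k) \<longlonglongrightarrow> qpoch_inf a p"
    by (rule LIMSEQ_Suc[OF qpoch_inf_LIMSEQ[OF assms]])
  ultimately show ?thesis
    using LIMSEQ_unique by blast
qed

text \<open>Euler's theorem on partitions into distinct and into odd parts: multiply by
  \<open>qpoch_inf q q\<close>, split by parity of the exponent, and cancel
  \<open>qpoch_inf (q\<^sup>2) (q\<^sup>2)\<close>.\<close>

lemma qpoch_inf_distinct_odd:
  assumes "norm q < 1"
  shows "qpoch_inf (-q) q = 1 / qpoch_inf q (q\<^sup>2)"
proof -
  have q2: "norm (q\<^sup>2) < 1"
    using assms by (simp add: norm_power power_less_one_iff)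
  have "qpoch_inf (-q) q * (qpoch_inf q (q\<^sup>2) * qpoch_inf (q\<^sup>2) (q\<^sup>2)) = qpoch_inf (q\<^sup>2) (q\<^sup>2)"
    using qpoch_inf_minus_mult[OF assms, of q] qpoch_inf_even_odd[OF assms, of q]
    by (simp add: power2_eq_square)
  then show ?thesis
    using qpoch_inf_nonzero[OF q2 q2] qpoch_inf_nonzero[OF assms q2] by (simp add: field_simps)
qed

text \<open>Pairing \<open>1 + z\<close> with \<open>1 - z\<close> twice, first in base
  \<open>q\<close> and then in base \<open>q\<^sup>2\<close>, gives the product side of Lebesgue's
  identity at \<open>a = 1\<close>.\<close>

lemma qpoch_inf_4_eq:
  assumes "norm q < 1"
  shows "qpoch_inf (q ^ 4) (q ^ 4) / qpoch_inf q q = qpoch_inf (-(q\<^sup>2)) (q\<^sup>2) * qpoch_inf (-q) q"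
proof -
  have q2: "norm (q\<^sup>2) < 1"
    using assms by (simp add: norm_power power_less_one_iff)
  have "qpoch_inf (-(q\<^sup>2)) (q\<^sup>2) * (qpoch_inf (-q) q * qpoch_inf q q) = qpoch_inf (q ^ 4) (q ^ 4)"
    using qpoch_inf_minus_mult[OF assms, of q] qpoch_inf_minus_mult[OF q2, of "q\<^sup>2"]
    by (simp flip: power_mult)
  then show ?thesis
    using qpoch_inf_nonzero[OF assms assms] by (simp add: field_simps)
qed

section \<open>The series\<close>

text \<open>Polymorphic so that the real instance at \<open>norm q\<close>, with
  \<open>a = x = 1\<close>, can majorize the complex terms.\<close>

definition lebesgue_term :: "'a::real_normed_field \<Rightarrow> 'a \<Rightarrow> 'a \<Rightarrow> nat \<Rightarrow> 'a" where
  "lebesgue_term q a x n =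
     (\<Prod>k<n. (1 + a * q ^ Suc k) / (1 - q ^ Suc k)) * q ^ (n choose 2) * x ^ n"

definition lebesgue_series :: "complex \<Rightarrow> complex \<Rightarrow> complex \<Rightarrow> complex" where
  "lebesgue_series q a x = (\<Sum>n. lebesgue_term q a x n)"

lemma lebesgue_term_0 [simp]: "lebesgue_term q a x 0 = 1"
  by (simp add: lebesgue_term_def binomial_eq_0)

lemma Suc_choose_2: "Suc n choose 2 = n + (n choose 2)"
  by (simp add: numeral_2_eq_2)

lemma lebesgue_term_Suc:
  "lebesgue_term q a x (Suc n) =
     lebesgue_term q a x n * ((1 + a * q ^ Suc n) / (1 - q ^ Suc n) * q ^ n * x)"
  by (simp add: lebesgue_term_def Suc_choose_2 power_add mult_ac)

lemma lebesgue_term_scale: "lebesgue_term q a (q * x) n = q ^ n * lebesgue_term q a x n"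
  by (simp add: lebesgue_term_def power_mult_distrib mult_ac)

text \<open>The extra factor extends the numerator product at its top end; peeling off the bottom
  factor \<open>1 + a * q\<close> leaves the product belonging to \<open>a * q\<close>.\<close>

lemma lebesgue_term_shift:
  "(1 + a * q ^ Suc n) * lebesgue_term q a x n = (1 + a * q) * lebesgue_term q (a * q) x n"
proof -
  have "(1 + a * q ^ Suc n) * (\<Prod>k<n. 1 + a * q ^ Suc k) = (\<Prod>k<Suc n. 1 + a * q ^ Suc k)"
    by simp
  also have "\<dots> = (1 + a * q) * (\<Prod>k<n. 1 + a * q * q ^ Suc k)"
    by (subst prod.lessThan_Suc_shift) (simp add: mult_ac)
  finally show ?thesis
    by (simp add: lebesgue_term_def prod_dividef mult_ac)
qed

section \<open>Convergence and passage to limits\<close>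

lemma summable_lebesgue_term_real:
  fixes r :: real
  assumes "0 \<le> r" "r < 1"
  shows "summable (lebesgue_term r 1 1)"
proof -
  \<comment> \<open>The ratio of consecutive terms tends to 0 because of its factor
    \<open>r ^ n\<close>, so 1/2 eventually bounds it.\<close>
  have "(\<lambda>n. (1 + 1 * r ^ Suc n) / (1 - r ^ Suc n) * r ^ n * 1) \<longlonglongrightarrow> (1 + 1 * 0) / (1 - 0) * 0 * 1"
    using assms by (intro tendsto_intros LIMSEQ_Suc[OF LIMSEQ_power_zero] LIMSEQ_power_zero) auto
  then have "\<forall>\<^sub>F n in sequentially. norm ((1 + 1 * r ^ Suc n) / (1 - r ^ Suc n) * r ^ n * 1) < 1 / 2"
    by (intro order_tendstoD(2)[OF tendsto_norm]) auto
  then obtain N where N: "\<And>n. n \<ge> N \<Longrightarrow>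
      norm ((1 + 1 * r ^ Suc n) / (1 - r ^ Suc n) * r ^ n * 1) < 1 / 2"
    unfolding eventually_sequentially by blast
  show ?thesis
  proof (rule summable_ratio_test)
    fix n assume "n \<ge> N"
    from mult_left_mono[OF less_imp_le[OF N[OF this]], of "norm (lebesgue_term r 1 1 n)"]
    show "norm (lebesgue_term r 1 1 (Suc n)) \<le> 1 / 2 * norm (lebesgue_term r 1 1 n)"
      unfolding lebesgue_term_Suc norm_mult[of "lebesgue_term r 1 1 n"] by simp
  qed simp
qed

context
  fixes q :: complex
  assumes q: "norm q < 1"
begin

lemma one_minus_power_nonzero: "1 - q ^ Suc n \<noteq> 0"
  using mult_power_neq_1[OF q q, of n] by simp

text \<open>The bound is uniform over the closed unit disc in \<open>a\<close> and \<open>x\<close>,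
  which serves both summability and dominated convergence.\<close>

lemma norm_lebesgue_term_le:
  assumes "norm a \<le> 1" "norm x \<le> 1"
  shows "norm (lebesgue_term q a x n) \<le> lebesgue_term (norm q) 1 1 n"
proof -
  have factor: "norm ((1 + a * q ^ Suc k) / (1 - q ^ Suc k))
      \<le> (1 + 1 * norm q ^ Suc k) / (1 - norm q ^ Suc k)" for k
    unfolding norm_divide
  proof (rule frac_le)
    show "norm (1 + a * q ^ Suc k) \<le> 1 + 1 * norm q ^ Suc k"
      using norm_triangle_ineq[of 1 "a * q ^ Suc k"] mult_right_mono[OF assms(1), of "norm q ^ Suc k"]
      by (simp add: norm_mult norm_power)
    show "1 - norm q ^ Suc k \<le> norm (1 - q ^ Suc k)"
      using norm_triangle_ineq2[of 1 "q ^ Suc k"] by (simp add: norm_mult norm_power)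
    show "0 < 1 - norm q ^ Suc k"
      using q power_Suc_less_one[of "norm q" k] by (cases "q = 0") auto
  qed simp
  then have "(\<Prod>k<n. norm ((1 + a * q ^ Suc k) / (1 - q ^ Suc k)))
      \<le> (\<Prod>k<n. (1 + 1 * norm q ^ Suc k) / (1 - norm q ^ Suc k))"
    by (intro prod_mono) auto
  then have "(\<Prod>k<n. norm ((1 + a * q ^ Suc k) / (1 - q ^ Suc k))) * norm q ^ (n choose 2) * norm x ^ n
      \<le> (\<Prod>k<n. (1 + 1 * norm q ^ Suc k) / (1 - norm q ^ Suc k)) * norm q ^ (n choose 2) * 1 ^ n"
    using assms(2)
    by (intro mult_mono power_mono mult_nonneg_nonneg zero_le_power prod_nonneg
        order.trans[OF norm_ge_zero factor]) auto
  then show ?thesis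
    by (simp only: lebesgue_term_def norm_mult norm_power prod_norm)
qed

lemma summable_lebesgue_term:
  assumes "norm a \<le> 1" "norm x \<le> 1"
  shows "summable (lebesgue_term q a x)"
  by (rule summable_comparison_test'[OF summable_lebesgue_term_real norm_lebesgue_term_le])
    (use q assms in auto)

lemma lebesgue_series_sums:
  assumes "norm a \<le> 1" "norm x \<le> 1"
  shows "lebesgue_term q a x sums lebesgue_series q a x"
  unfolding lebesgue_series_def using summable_lebesgue_term[OF assms] by (rule summable_sums)

text \<open>Tannery's theorem with the uniform majorant; it allows the iterated functional equations
  to be taken to their limits.\<close>

lemma tendsto_lebesgue_series:
  assumes "f \<longlonglongrightarrow> a" "g \<longlonglongrightarrow> x" "\<And>n. norm (f n) \<le> 1" "\<And>n. norm (g n) \<le> 1"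
  shows "(\<lambda>n. lebesgue_series q (f n) (g n)) \<longlonglongrightarrow> lebesgue_series q a x"
proof -
  have "(\<lambda>n. lebesgue_term q (f n) (g n) k) \<longlonglongrightarrow> lebesgue_term q a x k" for k
    unfolding lebesgue_term_def
    by (intro tendsto_intros assms) (rule one_minus_power_nonzero)
  moreover have "\<forall>\<^sub>F (k, n) in sequentially \<times>\<^sub>F sequentially.
      norm (lebesgue_term q (f n) (g n) k) \<le> lebesgue_term (norm q) 1 1 k"
    by (simp add: norm_lebesgue_term_le assms split_def)
  moreover have "summable (lebesgue_term (norm q) 1 1)"
    using q by (intro summable_lebesgue_term_real) auto
  ultimately show ?thesis
    unfolding lebesgue_series_def
    using tannerys_theorem[where a = "\<lambda>k n. lebesgue_term q (f n) (g n) k"] by simp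
qed

lemma norm_mult_q_le: "norm a \<le> 1 \<Longrightarrow> norm (a * q) \<le> 1" "norm a \<le> 1 \<Longrightarrow> norm (q * a) \<le> 1"
  using q mult_mono[of "norm a" 1 "norm q" 1] by (auto simp: norm_mult mult.commute)

section \<open>Functional equations\<close>

lemma lebesgue_series_shift:
  assumes a: "norm a \<le> 1" and x: "norm x \<le> 1"
  shows "lebesgue_series q a x + a * q * lebesgue_series q a (q * x)
    = (1 + a * q) * lebesgue_series q (a * q) x"
proof -
  note [intro] = lebesgue_series_sums a x norm_mult_q_le
  have "(\<lambda>n. lebesgue_term q a x n + a * q * lebesgue_term q a (q * x) n) sums
      (lebesgue_series q a x + a * q * lebesgue_series q a (q * x))"
    by (intro sums_add sums_mult) auto
  moreover have "lebesgue_term q a x n + a * q * lebesgue_term q a (q * x) n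
      = (1 + a * q) * lebesgue_term q (a * q) x n" for n
    using lebesgue_term_shift[of a q n x] by (simp add: lebesgue_term_scale algebra_simps)
  moreover have "(\<lambda>n. (1 + a * q) * lebesgue_term q (a * q) x n) sums
      ((1 + a * q) * lebesgue_series q (a * q) x)"
    by (intro sums_mult) auto
  ultimately show ?thesis
    using sums_unique2 by simp
qed

lemma lebesgue_series_diff:
  assumes a: "norm a \<le> 1" and x: "norm x \<le> 1"
  shows "lebesgue_series q a x - lebesgue_series q a (q * x)
    = x * (1 + a * q) * lebesgue_series q (a * q) (q * x)"
proof -
  note [intro] = lebesgue_series_sums a x norm_mult_q_le
  have "(\<lambda>n. lebesgue_term q a x n - lebesgue_term q a (q * x) n) sums
      (lebesgue_series q a x - lebesgue_series q a (q * x))"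
    by (intro sums_diff) auto
  \<comment> \<open>Both terms at index 0 equal 1 and cancel, so the sum may start at index
    1.\<close>
  then have "(\<lambda>n. lebesgue_term q a x (Suc n) - lebesgue_term q a (q * x) (Suc n)) sums
      (lebesgue_series q a x - lebesgue_series q a (q * x))"
    by (subst sums_Suc_iff) simp
  moreover have "lebesgue_term q a x (Suc n) - lebesgue_term q a (q * x) (Suc n)
      = x * (1 + a * q) * lebesgue_term q (a * q) (q * x) n" for n
  proof -
    have "lebesgue_term q a x (Suc n) - lebesgue_term q a (q * x) (Suc n)
        = (1 - q ^ Suc n) * lebesgue_term q a x (Suc n)"
      unfolding lebesgue_term_scale by (simp add: algebra_simps)
    \<comment> \<open>The factor \<open>1 - q ^ Suc n\<close> cancels the newest denominator,
      lowering the index by one.\<close>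
    also have "\<dots> = x * q ^ n * ((1 + a * q ^ Suc n) * lebesgue_term q a x n)"
      using one_minus_power_nonzero[of n] unfolding lebesgue_term_Suc by (simp del: power_Suc)
    also have "\<dots> = x * (1 + a * q) * lebesgue_term q (a * q) (q * x) n"
      unfolding lebesgue_term_shift lebesgue_term_scale by simp
    finally show ?thesis .
  qed
  moreover have "(\<lambda>n. x * (1 + a * q) * lebesgue_term q (a * q) (q * x) n) sums
      (x * (1 + a * q) * lebesgue_series q (a * q) (q * x))"
    by (intro sums_mult) auto
  ultimately show ?thesis
    using sums_unique2 by simp
qed

text \<open>The difference equation at \<open>a = 1\<close> moves to parameter \<open>q\<close>; the
  shift equation at argument \<open>q * x\<close> moves back to parameter 1.\<close>

lemma lebesgue_series_recurrence:
  assumes "norm x \<le> 1"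
  shows "lebesgue_series q 1 x
    = (1 + x) * lebesgue_series q 1 (q * x) + q * x * lebesgue_series q 1 (q * (q * x))"
proof -
  have "lebesgue_series q 1 x - lebesgue_series q 1 (q * x)
      = x * ((1 + q) * lebesgue_series q q (q * x))"
    using lebesgue_series_diff[of 1 x] assms by (simp add: mult.assoc)
  also have "(1 + q) * lebesgue_series q q (q * x)
      = lebesgue_series q 1 (q * x) + q * lebesgue_series q 1 (q * (q * x))"
    using lebesgue_series_shift[of 1 "q * x"] norm_mult_q_le(2)[OF assms] by simp
  finally show ?thesis
    by (simp add: algebra_simps)
qed

section \<open>Lebesgue's identity\<close>

lemma lebesgue_series_step:
  assumes a: "norm a \<le> 1"
  shows "lebesgue_series q a q = (1 + a * q\<^sup>2) * lebesgue_series q (a * q\<^sup>2) q"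
proof -
  let ?G = "lebesgue_series q"
  have "norm (a * q) < 1"
    using q mult_left_le_one_le[of "norm q" "norm a"] a by (simp add: norm_mult)
  then have nz: "1 + a * q \<noteq> 0"
    by (metis add_eq_0_iff norm_minus_cancel norm_one order_less_irrefl)
  \<comment> \<open>The regrouping exhibits the left-hand sides of the shift and difference
    equations at \<open>x = q\<close>. Both produce the factor \<open>1 + a * q\<close>, and what
    remains is the shift equation for \<open>a * q\<close>.\<close>
  have "(1 + a * q) * ?G a q = (?G a q + a * q * ?G a (q * q)) + a * (q * (?G a q - ?G a (q * q)))"
    by (simp add: algebra_simps)
  also have "\<dots> = (1 + a * q) * ?G (a * q) q + a * (q * (q * (1 + a * q) * ?G (a * q) (q * q)))"
    using lebesgue_series_shift[OF a, of q] lebesgue_series_diff[OF a, of q] q by simp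
  also have "\<dots> = (1 + a * q) * (?G (a * q) q + a * q * q * ?G (a * q) (q * q))"
    by (simp add: algebra_simps)
  also have "\<dots> = (1 + a * q) * ((1 + a * q * q) * ?G (a * q * q) q)"
    using lebesgue_series_shift[OF norm_mult_q_le(1)[OF a], of q] q by simp
  finally show ?thesis
    using nz by (simp add: power2_eq_square mult.assoc)
qed

text \<open>At \<open>a = 0\<close> the difference equation reads
  \<open>G(0, x) = (1 + x) G(0, qx)\<close>; iterating from \<open>x = q\<close> drives the argument
  to 0, where only the constant term survives.\<close>

lemma euler_series: "lebesgue_series q 0 q = qpoch_inf (-q) q"
proof -
  have pow: "norm (q ^ n) \<le> 1" for n
    using q by (simp add: norm_power power_le_one)
  have "lebesgue_series q 0 (q ^ Suc n) = (1 + q ^ Suc n) * lebesgue_series q 0 (q ^ Suc (Suc n))" for n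
    using lebesgue_series_diff[OF _ pow, of 0 "Suc n"] by (simp add: algebra_simps)
  then have "lebesgue_series q 0 q
      = (\<Prod>k<n. 1 - (-q) * q ^ k) * lebesgue_series q 0 (q ^ Suc n)" for n
    by (induction n) simp_all
  moreover have "(\<lambda>n. (\<Prod>k<n. 1 - (-q) * q ^ k) * lebesgue_series q 0 (q ^ Suc n))
      \<longlonglongrightarrow> qpoch_inf (-q) q * lebesgue_series q 0 0"
    using q by (intro tendsto_mult qpoch_inf_LIMSEQ tendsto_lebesgue_series tendsto_const
        LIMSEQ_Suc[OF LIMSEQ_power_zero] pow) auto
  moreover have "lebesgue_series q 0 0 = 1"
  proof -
    have "lebesgue_term q 0 0 n = 0" if "n \<noteq> 0" for n
      using that by (simp add: lebesgue_term_def)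
    then show ?thesis
      unfolding lebesgue_series_def using suminf_finite[of "{0}" "lebesgue_term q 0 0"] by simp
  qed
  ultimately show ?thesis
    using LIMSEQ_unique[OF tendsto_const] by fastforce
qed

text \<open>Each step multiplies the parameter by \<open>q\<^sup>2\<close>, so it tends to 0 and
  Euler's series supplies the remaining factor.\<close>

lemma lebesgue_identity:
  assumes a: "norm a \<le> 1"
  shows "lebesgue_series q a q = qpoch_inf (-(a * q\<^sup>2)) (q\<^sup>2) * qpoch_inf (-q) q"
proof -
  have q2: "norm (q\<^sup>2) < 1"
    using q by (simp add: norm_power power_less_one_iff)
  have norm_le: "norm (a * (q\<^sup>2) ^ n) \<le> 1" for n
    using a q2 by (simp add: norm_mult norm_power mult_le_one power_le_one)
  have "lebesgue_series q a q
      = (\<Prod>k<n. 1 - (-(a * q\<^sup>2)) * (q\<^sup>2) ^ k) * lebesgue_series q (a * (q\<^sup>2) ^ n) q" for n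
  proof (induction n)
    case (Suc n)
    then show ?case
      using lebesgue_series_step[OF norm_le[of n]] by (simp add: mult_ac)
  qed simp
  moreover have "(\<lambda>n. (\<Prod>k<n. 1 - (-(a * q\<^sup>2)) * (q\<^sup>2) ^ k) * lebesgue_series q (a * (q\<^sup>2) ^ n) q)
      \<longlonglongrightarrow> qpoch_inf (-(a * q\<^sup>2)) (q\<^sup>2) * lebesgue_series q 0 q"
    using q by (intro tendsto_mult qpoch_inf_LIMSEQ tendsto_lebesgue_series tendsto_const
        tendsto_mult_right_zero LIMSEQ_power_zero q2 norm_le) auto
  ultimately show ?thesis
    using LIMSEQ_unique[OF tendsto_const] unfolding euler_series by fastforce
qed

section \<open>Initial values and the summand of the theorem\<close>

lemma lebesgue_series_1_q:
  "lebesgue_series q 1 q = qpoch_inf (q ^ 4) (q ^ 4) / qpoch_inf q q"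
  using lebesgue_identity[of 1] qpoch_inf_4_eq[OF q] by simp

lemma lebesgue_series_1_1:
  "lebesgue_series q 1 1 = qpoch_inf (-q) (q\<^sup>2) / qpoch_inf q (q\<^sup>2)
     + qpoch_inf (q ^ 4) (q ^ 4) / qpoch_inf q q"
proof -
  have q2: "norm (q\<^sup>2) < 1"
    using q by (simp add: norm_power power_less_one_iff)
  have "lebesgue_series q 1 1 = (1 + q) * lebesgue_series q q q + lebesgue_series q 1 q"
    using lebesgue_series_diff[of 1 1] by (simp add: algebra_simps)
  \<comment> \<open>Lebesgue's identity at \<open>a = q\<close> gives a product starting at
    \<open>1 + q ^ 3\<close>; the factor \<open>1 + q\<close> is its missing first factor.\<close>
  also have "(1 + q) * lebesgue_series q q q = qpoch_inf (-q) (q\<^sup>2) * qpoch_inf (-q) q"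
    using lebesgue_identity[of q] qpoch_inf_split_first[OF q2, of "-q"] q by simp
  finally show ?thesis
    unfolding lebesgue_series_1_q qpoch_inf_distinct_odd[OF q] by simp
qed

text \<open>The exponent equals \<open>(n choose 2) + m * n\<close>, so the integer division is
  exact and the integer power is a natural one.\<close>

lemma qpoch_summand_eq:
  "qpoch (-q) q n * q powi ((int n * (int n + 2 * int m - 1)) div 2) / qpoch q q n
    = lebesgue_term q 1 (q ^ m) n"
proof -
  have "2 * int (n choose 2) = int n * (int n - 1)"
    by (induction n) (simp_all add: Suc_choose_2 algebra_simps)
  then have "(int n * (int n + 2 * int m - 1)) div 2 = int ((n choose 2) + m * n)"
    by (simp add: algebra_simps)
  moreover have "qpoch (-q) q n = (\<Prod>k<n. 1 + q ^ Suc k)"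
    using q by (subst qpoch_eq_prod) (use mult_power_neq_1[of "-q" q] in auto)
  moreover have "qpoch q q n = (\<Prod>k<n. 1 - q ^ Suc k)"
    using q by (subst qpoch_eq_prod) (use mult_power_neq_1[of q q] in auto)
  ultimately show ?thesis
    by (simp add: lebesgue_term_def prod_dividef power_add power_mult del: of_nat_add of_nat_mult)
qed

end

section \<open>Solving the three-term recurrence\<close>

text \<open>The weight \<open>(-1) ^ m * q ^ (m choose 2)\<close> turns the recurrence of
  \<open>F\<close> into that of \<open>Q\<close> and \<open>R\<close> with index lowered by one, so
  agreement at \<open>m = 0\<close> and \<open>m = 1\<close> suffices.\<close>

lemma q_fibonacci_combination:
  fixes q A B :: complex and Q R :: "int \<Rightarrow> complex" and F :: "nat \<Rightarrow> complex"
  assumes F: "F 0 = A * Q (-1) - B * R (-1)" "F 1 = B * R 0 - A * Q 0"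
      "\<And>m. F m = (1 + q ^ m) * F (Suc m) + q ^ Suc m * F (Suc (Suc m))"
    and Q: "\<And>k. k \<ge> 1 \<Longrightarrow> Q k = (1 + q powi (k - 1)) * Q (k - 1) + q powi (k - 1) * Q (k - 2)"
    and R: "\<And>k. k \<ge> 1 \<Longrightarrow> R k = (1 + q powi (k - 1)) * R (k - 1) + q powi (k - 1) * R (k - 2)"
  shows "q ^ (m choose 2) * F m = (-1) ^ m * (A * Q (int m - 1) - B * R (int m - 1))"
proof (induction m rule: induct_nat_012)
  case (ge2 n)
  define U where "U k = A * Q k - B * R k" for k
  \<comment> \<open>The case \<open>n = 0\<close> uses the recurrences at
    \<open>k = 1\<close>.\<close>
  have U: "U (int (Suc n)) = (1 + q ^ n) * U (int n) + q ^ n * U (int n - 1)"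
    using Q[of "int (Suc n)"] R[of "int (Suc n)"] by (simp add: U_def algebra_simps)
  have IH: "q ^ (n choose 2) * F n = (-1) ^ n * U (int n - 1)"
    "q ^ n * q ^ (n choose 2) * F (Suc n) = - ((-1) ^ n * U (int n))"
    using ge2 by (simp_all add: U_def Suc_choose_2 power_add algebra_simps)
  \<comment> \<open>The weight grows by \<open>q ^ n * q ^ Suc n\<close>; the second power is the
    coefficient of \<open>F (Suc (Suc n))\<close> in its recurrence.\<close>
  have "q ^ (Suc (Suc n) choose 2) * F (Suc (Suc n))
      = q ^ n * q ^ (n choose 2) * (q ^ Suc n * F (Suc (Suc n)))"
    by (simp add: Suc_choose_2 power_add mult_ac)
  also have "q ^ Suc n * F (Suc (Suc n)) = F n - (1 + q ^ n) * F (Suc n)"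
    using F(3)[of n] by simp
  also have "q ^ n * q ^ (n choose 2) * \<dots>
      = q ^ n * (q ^ (n choose 2) * F n) - (1 + q ^ n) * (q ^ n * q ^ (n choose 2) * F (Suc n))"
    by (simp add: algebra_simps)
  also have "\<dots> = (-1) ^ Suc (Suc n) * U (int (Suc n))"
    unfolding IH U by (simp add: algebra_simps)
  finally show ?case
    by (simp add: U_def)
qed (use F(1,2) in \<open>simp_all add: binomial_eq_0\<close>)

theorem theorem2p1:
  fixes q :: complex and Q R :: "int \<Rightarrow> complex" and m :: nat
  assumes "0 < norm q" and "norm q < 1"
    and "Q (-1) = 1" and "Q 0 = 0" and "Q 1 = 1"
    and "\<And>k. k \<ge> 2 \<Longrightarrow> Q k = (1 + q powi (k - 1)) * Q (k - 1) + q powi (k - 1) * Q (k - 2)"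
    and "R (-1) = -1" and "R 0 = 1" and "R 1 = 1"
    and "\<And>k. k \<ge> 2 \<Longrightarrow> R k = (1 + q powi (k - 1)) * R (k - 1) + q powi (k - 1) * R (k - 2)"
  shows "(\<lambda>n. qpoch (-q) q n * q powi ((int n * (int n + 2 * int m - 1)) div 2) / qpoch q q n) sums
     ((-1) ^ m * q powi (- int (m choose 2)) * Q (int m - 1)
        * (qpoch_inf (-q) (q\<^sup>2) / qpoch_inf q (q\<^sup>2))
      - (-1) ^ m * q powi (- int (m choose 2)) * R (int m - 1)
        * (qpoch_inf (q ^ 4) (q ^ 4) / qpoch_inf q q))"
proof -
  let ?A = "qpoch_inf (-q) (q\<^sup>2) / qpoch_inf q (q\<^sup>2)"
  let ?B = "qpoch_inf (q ^ 4) (q ^ 4) / qpoch_inf q q"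
  have "q \<noteq> 0"
    using assms(1) by auto
  have pow: "norm (q ^ k) \<le> 1" for k
    using assms(2) by (simp add: norm_power power_le_one)
  \<comment> \<open>The values at -1 make the recurrences hold at \<open>k = 1\<close> too:
    \<open>1 = 2 * 0 + 1\<close> for \<open>Q\<close> and \<open>1 = 2 * 1 - 1\<close> for
    \<open>R\<close>.\<close>
  have Q: "Q k = (1 + q powi (k - 1)) * Q (k - 1) + q powi (k - 1) * Q (k - 2)" if "k \<ge> 1" for k
    using assms(3-6) that by (cases "k = 1") auto
  have R: "R k = (1 + q powi (k - 1)) * R (k - 1) + q powi (k - 1) * R (k - 2)" if "k \<ge> 1" for k
    using assms(7-10) that by (cases "k = 1") auto
  have "q ^ (m choose 2) * lebesgue_series q 1 (q ^ m)
      = (-1) ^ m * (?A * Q (int m - 1) - ?B * R (int m - 1))"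
  proof (rule q_fibonacci_combination[where F = "\<lambda>m. lebesgue_series q 1 (q ^ m)"])
    show "lebesgue_series q 1 (q ^ k) = (1 + q ^ k) * lebesgue_series q 1 (q ^ Suc k)
        + q ^ Suc k * lebesgue_series q 1 (q ^ Suc (Suc k))" for k
      using lebesgue_series_recurrence[OF assms(2) pow[of k]] by simp
  \<comment> \<open>The initial values required are \<open>?A + ?B\<close> at \<open>m = 0\<close>
    and \<open>?B\<close> at \<open>m = 1\<close>.\<close>
  qed (use lebesgue_series_1_1[OF assms(2)] lebesgue_series_1_q[OF assms(2)] assms Q R in auto)
  then have "lebesgue_series q 1 (q ^ m) =
      (-1) ^ m * (?A * Q (int m - 1) - ?B * R (int m - 1)) / q ^ (m choose 2)"
    using \<open>q \<noteq> 0\<close> by (metis nonzero_mult_div_cancel_left power_not_zero)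
  also have "\<dots> = (-1) ^ m * q powi (- int (m choose 2)) * Q (int m - 1) * ?A
      - (-1) ^ m * q powi (- int (m choose 2)) * R (int m - 1) * ?B"
    by (simp add: power_int_minus divide_inverse algebra_simps)
  finally show ?thesis
    using lebesgue_series_sums[OF assms(2), of 1 "q ^ m"] pow
    unfolding qpoch_summand_eq[OF assms(2)] by simp
qed

end
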